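(* If affine replication $\mathrm{AR}(m,k)$ is applied to any geometric $(m_{k-1})$ configuration, the result is a geometric $(((k+1)m)_k)$ configuration with a pencil of $m$ parallel lines (i.e. $m$ of its lines are pairwise parallel).
   Context: A geometric $(n_k)$ configuration is a set of $n$ distinct points and $n$ distinct (straight) lines in the real Euclidean plane such that each of the points lies on exactly $k$ of the lines and each of the lines contains exactly $k$ of the points. An orthogonal axial affinity with axis a line $A$ is a non-identity affine transformation of the plane that fixes every point of $A$ and moves each point along the perpendicular to $A$ through that point, multiplying the signed distance from $A$ by a fixed nonzero ratio. Affine replication $\mathrm{AR}(m,k)$ applied to an $(m_{k-1})$ configuration $\mathcal C$ is the following construction. (1) Let $A$ be a line that (i) does not pass through the intersection of two lines of $\mathcal C$, whether or not that intersection point is a point of the configuration; (ii) is perpendicular to no line connecting any two points of $\mathcal C$, whether or not that line is a line of the configuration; (iii) intersects all lines of $\mathcal C$. (2) Let $\alpha_1,\dots,\alpha_{k-1}$ be pairwise different orthogonal axial affinities with axis $A$, and put $\mathcal C_0=\mathcal C$ and $\mathcal C_i=\alpha_i(\mathcal C)$ for $1\le i\le k-1$. (3) For each line $\ell$ of $\mathcal C$, let $F_\ell=A\cap\ell$, which is a common point of the lines $\ell,\alpha_1(\ell),\dots,\alpha_{k-1}(\ell)$, and let $\mathcal F$ be the set of all the points $F_\ell$. (4) For each point $P$ of $\mathcal C$, let $\ell_P$ be the line perpendicular to $A$ that contains the points $P,\alpha_1(P),\dots,\alpha_{k-1}(P)$, and let $\mathcal L$ be the set of all the lines $\ell_P$.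 (5) The result is $\mathcal D=\mathcal C_0\cup\mathcal C_1\cup\dots\cup\mathcal C_{k-1}\cup\mathcal F\cup\mathcal L$, i.e. its points are the points of all the $\mathcal C_i$ together with those of $\mathcal F$, and its lines are the lines of all the $\mathcal C_i$ together with those of $\mathcal L$.
   Formalization: Added assumption, as the claim fails without it: α_i(P) lies on α_j(ℓ) only if P lies on ℓ (α_0 the identity), and no F_ℓ lies on any ℓ_P; it is also proved that every configuration admits an axis and affinities satisfying this. *)

theory Defs
  imports "HOL-Analysis.Analysis"
begin

type_synonym point = "real ^ 2"

(* a pair of a set of points and a set of lines *)
type_synonym configuration = "point set \<times> point set set"

definition is_line :: "point set \<Rightarrow> bool" where
  "is_line l \<longleftrightarrow> affine l \<and> aff_dim l = 1"

definition perpendicular :: "point set \<Rightarrow> point set \<Rightarrow> bool" where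
  "perpendicular S T \<longleftrightarrow> (\<forall>a\<in>S. \<forall>b\<in>S. \<forall>c\<in>T. \<forall>d\<in>T. (a - b) \<bullet> (c - d) = 0)"

definition geometric_configuration :: "nat \<Rightarrow> nat \<Rightarrow> configuration \<Rightarrow> bool" where
  "geometric_configuration n k C \<longleftrightarrow>
     finite (fst C) \<and> card (fst C) = n \<and>
     finite (snd C) \<and> card (snd C) = n \<and>
     (\<forall>l\<in>snd C. is_line l) \<and>
     (\<forall>P\<in>fst C. card {l \<in> snd C. P \<in> l} = k) \<and>
     (\<forall>l\<in>snd C. card {P \<in> fst C. P \<in> l} = k)"

(* For a line A, "closest_point A P" is the foot of the perpendicular from P to A, so the
   formula multiplies the signed distance from A by r; it makes f affine and A pointwise fixed. *)
definition orthogonal_axial_affinity :: "point set \<Rightarrow> (point \<Rightarrow> point) \<Rightarrow> bool" where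
  "orthogonal_axial_affinity A f \<longleftrightarrow>
     f \<noteq> id \<and>
     (\<exists>r. r \<noteq> 0 \<and> (\<forall>P. f P = closest_point A P + r *\<^sub>R (P - closest_point A P)))"

(* The axis has to meet each line in exactly one point for axis_point to be well defined;
   meeting it at all is enough if every line contains two points and every point lies on two lines. *)
definition replication_axis :: "configuration \<Rightarrow> point set \<Rightarrow> bool" where
  "replication_axis C A \<longleftrightarrow>
     is_line A \<and>
     (\<forall>l\<in>snd C. \<forall>l'\<in>snd C. l \<noteq> l' \<longrightarrow> A \<inter> (l \<inter> l') = {}) \<and>
     (\<forall>P\<in>fst C. \<forall>Q\<in>fst C. P \<noteq> Q \<longrightarrow> \<not> perpendicular A (affine hull {P, Q})) \<and>
     (\<forall>l\<in>snd C. \<exists>F. A \<inter> l = {F})"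

definition replication_affinities :: "nat \<Rightarrow> point set \<Rightarrow> (nat \<Rightarrow> point \<Rightarrow> point) \<Rightarrow> bool" where
  "replication_affinities k A \<alpha> \<longleftrightarrow>
     (\<forall>i\<in>{1..k - 1}. orthogonal_axial_affinity A (\<alpha> i)) \<and> inj_on \<alpha> {1..k - 1}"

(* index 0 stands for the original configuration, whatever the value of \<alpha> 0 *)
definition replica_map :: "(nat \<Rightarrow> point \<Rightarrow> point) \<Rightarrow> nat \<Rightarrow> point \<Rightarrow> point" where
  "replica_map \<alpha> i = (if i = 0 then id else \<alpha> i)"

definition replica :: "(nat \<Rightarrow> point \<Rightarrow> point) \<Rightarrow> nat \<Rightarrow> configuration \<Rightarrow> configuration" where
  "replica \<alpha> i C = (replica_map \<alpha> i ` fst C, (\<lambda>l. replica_map \<alpha> i ` l) ` snd C)"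

definition axis_point :: "point set \<Rightarrow> point set \<Rightarrow> point" where
  "axis_point A l = the_elem (A \<inter> l)"

definition perpendicular_through :: "point set \<Rightarrow> point \<Rightarrow> point set" where
  "perpendicular_through A P = {X. \<forall>a\<in>A. \<forall>b\<in>A. (X - P) \<bullet> (a - b) = 0}"

definition affine_replication ::
  "nat \<Rightarrow> point set \<Rightarrow> (nat \<Rightarrow> point \<Rightarrow> point) \<Rightarrow> configuration \<Rightarrow> configuration" where
  "affine_replication k A \<alpha> C =
     ((\<Union>i<k. fst (replica \<alpha> i C)) \<union> axis_point A ` snd C,
      (\<Union>i<k. snd (replica \<alpha> i C)) \<union> perpendicular_through A ` fst C)"

(* General position: a point of one replica lies on a line of another (or the same) replica only
   if the original point lies on the original line, and no axis point lies on an added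
   perpendicular. Neither follows from the conditions on the axis and the affinities:
   - for the triangle (0,1), (1,3), (2,4) and the axis y = 0, the affinity of ratio 2 maps (0,1)
     to (0,2), which lies on the side y = x + 2 of the original triangle;
   - for the triangle (0,3), (1,1), (2,2) and the axis y = 0, the side y = x meets the axis in
     (0,0), which lies on the perpendicular x = 0 through (0,3), whatever the affinities. *)
definition no_unintended_incidences ::
  "nat \<Rightarrow> point set \<Rightarrow> (nat \<Rightarrow> point \<Rightarrow> point) \<Rightarrow> configuration \<Rightarrow> bool" where
  "no_unintended_incidences k A \<alpha> C \<longleftrightarrow>
     (\<forall>P\<in>fst C. \<forall>l\<in>snd C. \<forall>i<k. \<forall>j<k.
        replica_map \<alpha> i P \<in> replica_map \<alpha> j ` l \<longrightarrow> P \<in> l) \<and>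
     (\<forall>P\<in>fst C. \<forall>l\<in>snd C. axis_point A l \<notin> perpendicular_through A P)"

definition has_parallel_pencil :: "nat \<Rightarrow> configuration \<Rightarrow> bool" where
  "has_parallel_pencil m C \<longleftrightarrow>
     (\<exists>M\<subseteq>snd C. finite M \<and> card M = m \<and> (\<forall>l\<in>M. \<forall>l'\<in>M. affine_parallel l l'))"

end

theory Submission
  imports Defs
begin

text \<open>
  Work in the orthonormal frame of the axis \<open>A = {x. n \<bullet> x = c}\<close>, with unit normal \<open>n\<close>
  and unit direction \<open>turn n\<close>. An orthogonal axial affinity keeps the coordinate along the axis
  and multiplies the signed height \<open>n \<bullet> x - c\<close> by a ratio \<open>r\<close>; the perpendicular through
  \<open>P\<close> is the set of all points with the same coordinate along the axis as \<open>P\<close>.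

  \<^bold>\<open>The counts.\<close> Let \<open>P\<close> be a point and \<open>l\<close> a line of the original configuration, and let
  \<open>s\<^sub>i\<close> be the affinities, \<open>s\<^sub>0\<close> being the identity. General position leaves exactly these
  incidences: \<open>s\<^sub>i P\<close> lies on \<open>s\<^sub>j l\<close> iff \<open>i = j\<close> and \<open>P\<close> lies on \<open>l\<close>; the axis point of
  \<open>l\<close> lies on \<open>s\<^sub>i l'\<close> iff \<open>l = l'\<close>; \<open>s\<^sub>i P\<close> lies on the perpendicular through \<open>Q\<close> iff
  \<open>P = Q\<close>; axis points lie on no added perpendicular. The crucial one is the first for \<open>i \<noteq> j\<close>: if
  \<open>s\<^sub>i P\<close> were on \<open>s\<^sub>j l\<close> although \<open>P\<close> is on \<open>l\<close>, then \<open>l\<close> would contain two points of one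
  perpendicular to \<open>A\<close>, hence be that perpendicular, and its axis point would lie on it.
  As soon as \<open>k > 1\<close>, every point is on a line and every line has a point, so these four
  rules also separate all the points and all the lines from each other; for \<open>k = 1\<close> there is
  only one replica. The required numbers follow: \<open>s\<^sub>i P\<close> is on \<open>k - 1\<close> lines of its replica and on one
  perpendicular, an axis point is on \<open>k\<close> replicas of its line, \<open>s\<^sub>i l\<close> has \<open>k - 1\<close>
  replicated points and one axis point, and a perpendicular has \<open>k\<close> replicas of one point.
  The \<open>m\<close> perpendiculars are the pencil.

  \<^bold>\<open>Existence of general position.\<close> Every requirement excludes only finitely many values of a
  parameter. First the direction of the axis is chosen so that no line of the configuration is
  parallel or perpendicular to the axis and no two points have a connecting line perpendicular to
  it; then the offset \<open>c\<close>, so that the axis misses the intersections of lines and the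
  axis points avoid the perpendiculars; finally the ratios \<open>T ^ i\<close> with \<open>T\<close> so
  large that no quotient \<open>T ^ i / T ^ j\<close> with \<open>i \<noteq> j\<close> hits one of the finitely many ratios that
  would move a point onto a line not containing it.
\<close>

section \<open>Lines in the plane and the frame of an axis\<close>

definition turn :: "point \<Rightarrow> point" where
  "turn v = vector [- (v $ 2), v $ 1]"

lemma inner_plane: "x \<bullet> y = x $ 1 * y $ 1 + x $ 2 * y $ 2" for x y :: point
  by (simp add: inner_vec_def sum_2)

lemma turn_nth [simp]: "turn v $ 1 = - (v $ 2)" "turn v $ 2 = v $ 1"
  by (simp_all add: turn_def)

lemma turn_inner_self [simp]: "turn v \<bullet> v = 0" "v \<bullet> turn v = 0"
  by (simp_all add: inner_plane)

lemma turn_eq_0_iff [simp]: "turn v = 0 \<longleftrightarrow> v = 0"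
  by (auto simp: vec_eq_iff forall_2)

lemma turn_inner_turn: "turn v \<bullet> turn w = v \<bullet> w"
  by (simp add: inner_plane)

lemma inner_turn_left: "turn v \<bullet> w = - (v \<bullet> turn w)"
  by (simp add: inner_plane)

lemma plane_frame:
  assumes "n \<bullet> n = 1"
  shows "x \<bullet> y = (n \<bullet> x) * (n \<bullet> y) + (turn n \<bullet> x) * (turn n \<bullet> y)"
proof -
  have "(n \<bullet> x) * (n \<bullet> y) + (turn n \<bullet> x) * (turn n \<bullet> y) = (n \<bullet> n) * (x \<bullet> y)"
    by (simp add: inner_plane algebra_simps)
  with assms show ?thesis by simp
qed

lemma plane_frame_eqI:
  assumes "n \<bullet> n = 1" "n \<bullet> x = n \<bullet> y" "turn n \<bullet> x = turn n \<bullet> y"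
  shows "x = y"
proof -
  have "(x - y) \<bullet> (x - y) = 0"
    using assms by (subst plane_frame[OF assms(1)]) (simp add: inner_diff_right)
  then show ?thesis by simp
qed

lemma is_line_iff_hyperplane:
  "is_line l \<longleftrightarrow> (\<exists>u b. u \<noteq> 0 \<and> l = {x. u \<bullet> x = b})"
proof
  assume "is_line l"
  then have "affine l" "aff_dim l = int DIM(point) - 1"
    by (auto simp: is_line_def)
  then show "\<exists>u b. u \<noteq> 0 \<and> l = {x. u \<bullet> x = b}"
    using aff_dim_eq_hyperplane[of l] hull_same[of affine l] by auto
next
  assume "\<exists>u b. u \<noteq> 0 \<and> l = {x. u \<bullet> x = b}"
  then obtain u b where "u \<noteq> 0" "l = {x. u \<bullet> x = b}" by auto
  then show "is_line l"
    using aff_dim_hyperplane[of u b] affine_hyperplane[of u b] by (auto simp: is_line_def)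
qed

lemma is_line_unit_normal:
  assumes "is_line A"
  obtains n c where "n \<bullet> n = 1" "A = {x. n \<bullet> x = c}"
proof -
  obtain u b where u: "u \<noteq> 0" "A = {x. u \<bullet> x = b}"
    using assms is_line_iff_hyperplane by blast
  define n where "n = u /\<^sub>R norm u"
  have "n \<bullet> n = 1"
    using u(1) by (simp add: n_def dot_square_norm power2_eq_square)
  moreover have "A = {x. n \<bullet> x = b / norm u}"
    using u by (auto simp: n_def field_simps)
  ultimately show thesis by (rule that)
qed

lemma closest_point_line:
  assumes "n \<bullet> n = 1"
  shows "closest_point {x. n \<bullet> x = c} P = P - (n \<bullet> P - c) *\<^sub>R n"
proof (rule closest_point_unique[symmetric])
  show "convex {x. n \<bullet> x = c}" by (rule convex_hyperplane)
  show "closed {x. n \<bullet> x = c}" by (rule closed_hyperplane)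
  show "P - (n \<bullet> P - c) *\<^sub>R n \<in> {x. n \<bullet> x = c}"
    using assms by (simp add: inner_diff_right)
  have norm_n: "norm n = 1" using assms by (simp add: norm_eq_1)
  show "\<forall>z\<in>{x. n \<bullet> x = c}. dist P (P - (n \<bullet> P - c) *\<^sub>R n) \<le> dist P z"
  proof
    fix z assume "z \<in> {x. n \<bullet> x = c}"
    then have "\<bar>n \<bullet> P - c\<bar> = \<bar>n \<bullet> (P - z)\<bar>" by (simp add: inner_diff_right)
    also have "\<dots> \<le> norm n * norm (P - z)" by (rule Cauchy_Schwarz_ineq2)
    finally show "dist P (P - (n \<bullet> P - c) *\<^sub>R n) \<le> dist P z"
      by (simp add: dist_norm norm_n)
  qed
qed

section \<open>Axial affinities and perpendiculars in the frame\<close>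

definition stretch :: "point \<Rightarrow> real \<Rightarrow> real \<Rightarrow> point \<Rightarrow> point" where
  "stretch n c r P = P + ((r - 1) * (n \<bullet> P - c)) *\<^sub>R n"

lemma stretch_1 [simp]: "stretch n c 1 = id"
  by (auto simp: stretch_def)

lemma turn_inner_stretch [simp]: "turn n \<bullet> stretch n c r P = turn n \<bullet> P"
  by (simp add: stretch_def inner_add_right)

lemma height_stretch:
  assumes "n \<bullet> n = 1"
  shows "n \<bullet> stretch n c r P - c = r * (n \<bullet> P - c)"
  using assms by (simp add: stretch_def inner_add_right algebra_simps)

lemma stretch_stretch:
  assumes "n \<bullet> n = 1"
  shows "stretch n c r (stretch n c q P) = stretch n c (r * q) P"
proof -
  have "n \<bullet> stretch n c r (stretch n c q P) - c = n \<bullet> stretch n c (r * q) P - c"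
    by (simp add: height_stretch[OF assms])
  then show ?thesis
    by (intro plane_frame_eqI[OF assms]) simp_all
qed

lemma stretch_eq_iff:
  assumes "n \<bullet> n = 1" "q \<noteq> 0"
  shows "stretch n c r P = stretch n c q X \<longleftrightarrow> X = stretch n c (r / q) P"
proof
  assume "stretch n c r P = stretch n c q X"
  then have "stretch n c (1 / q) (stretch n c r P) = stretch n c (1 / q) (stretch n c q X)"
    by simp
  with assms show "X = stretch n c (r / q) P"
    by (simp add: stretch_stretch)
next
  assume "X = stretch n c (r / q) P"
  with assms show "stretch n c r P = stretch n c q X"
    by (simp add: stretch_stretch)
qed

lemma inj_stretch:
  assumes "n \<bullet> n = 1" "r \<noteq> 0"
  shows "inj (stretch n c r)"
  by (rule injI) (use assms in \<open>simp add: stretch_eq_iff\<close>)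

lemma stretch_on_axis: "n \<bullet> P = c \<Longrightarrow> stretch n c r P = P"
  by (simp add: stretch_def)

text \<open>A point off the axis recovers the ratio from the affinity.\<close>

lemma stretch_ratio_inj:
  assumes "n \<bullet> n = 1" "stretch n c r = stretch n c q"
  shows "r = q"
proof -
  have "n \<bullet> stretch n c r ((c + 1) *\<^sub>R n) - c = n \<bullet> stretch n c q ((c + 1) *\<^sub>R n) - c"
    using assms(2) by simp
  with assms(1) show ?thesis
    by (simp add: height_stretch)
qed

lemma orthogonal_axial_affinity_iff_stretch:
  assumes n: "n \<bullet> n = 1"
  shows "orthogonal_axial_affinity {x. n \<bullet> x = c} f \<longleftrightarrow>
    (\<exists>r. r \<noteq> 0 \<and> r \<noteq> 1 \<and> f = stretch n c r)"
proof -
  have formula: "closest_point {x. n \<bullet> x = c} P + r *\<^sub>R (P - closest_point {x. n \<bullet> x = c} P)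
      = stretch n c r P" for r P
    by (simp add: closest_point_line[OF n] stretch_def algebra_simps)
  have "stretch n c r \<noteq> id \<longleftrightarrow> r \<noteq> 1" for r
    using stretch_ratio_inj[OF n, of c r 1] by auto
  then show ?thesis
    unfolding orthogonal_axial_affinity_def formula by (auto simp: fun_eq_iff)
qed

lemma is_line_stretch_image:
  assumes n: "n \<bullet> n = 1" and r: "r \<noteq> 0" and l: "is_line l"
  shows "is_line (stretch n c r ` l)"
proof -
  obtain u b where u: "u \<noteq> 0" "l = {x. u \<bullet> x = b}"
    using l is_line_iff_hyperplane by blast
  \<comment> \<open>The inverse affinity has ratio \<open>1 / r\<close>; pulling the equation of \<open>l\<close> back along it
    scales the \<open>n\<close>-coordinate of the normal vector by \<open>1 / r\<close>.\<close>
  define w where "w = u + ((1 / r - 1) * (u \<bullet> n)) *\<^sub>R n"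
  have pull: "u \<bullet> stretch n c (1 / r) y = w \<bullet> y - (1 / r - 1) * (u \<bullet> n) * c" for y
    by (simp add: stretch_def w_def inner_add_left inner_add_right algebra_simps)
  have "stretch n c r ` l = {y. u \<bullet> stretch n c (1 / r) y = b}"
  proof (intro set_eqI iffI)
    fix y assume "y \<in> {y. u \<bullet> stretch n c (1 / r) y = b}"
    then have "stretch n c (1 / r) y \<in> l" by (simp add: u)
    moreover have "y = stretch n c r (stretch n c (1 / r) y)"
      using r by (simp add: stretch_stretch[OF n])
    ultimately show "y \<in> stretch n c r ` l" by (rule rev_image_eqI)
  qed (use r in \<open>auto simp: u stretch_stretch[OF n]\<close>)
  also have "\<dots> = {y. w \<bullet> y = b + (1 / r - 1) * (u \<bullet> n) * c}"
    by (auto simp: pull)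
  finally have image: "stretch n c r ` l = {y. w \<bullet> y = b + (1 / r - 1) * (u \<bullet> n) * c}" .
  have "w \<noteq> 0"
  proof
    assume "w = 0"
    moreover have "n \<bullet> w = (n \<bullet> u) / r"
      using n by (simp add: w_def inner_add_right inner_commute algebra_simps)
    moreover have "turn n \<bullet> w = turn n \<bullet> u"
      by (simp add: w_def inner_add_right)
    ultimately have "u = 0"
      using r by (intro plane_frame_eqI[OF n]) auto
    with u show False by simp
  qed
  with image show ?thesis
    by (auto simp: is_line_iff_hyperplane)
qed

lemma perpendicular_through_hyperplane:
  assumes n: "n \<bullet> n = 1"
  shows "perpendicular_through {x. n \<bullet> x = c} P = {X. turn n \<bullet> X = turn n \<bullet> P}"
proof (intro set_eqI iffI)
  fix X assume X: "X \<in> perpendicular_through {x. n \<bullet> x = c} P"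
  \<comment> \<open>Two points of the axis whose difference is its unit direction.\<close>
  have "c *\<^sub>R n + turn n \<in> {x. n \<bullet> x = c}" "c *\<^sub>R n \<in> {x. n \<bullet> x = c}"
    using n by (simp_all add: inner_add_right)
  with X have "(X - P) \<bullet> (c *\<^sub>R n + turn n - c *\<^sub>R n) = 0"
    unfolding perpendicular_through_def by blast
  then show "X \<in> {X. turn n \<bullet> X = turn n \<bullet> P}"
    by (simp add: inner_commute inner_diff_right)
next
  fix X assume "X \<in> {X. turn n \<bullet> X = turn n \<bullet> P}"
  then show "X \<in> perpendicular_through {x. n \<bullet> x = c} P"
    by (auto simp: perpendicular_through_def plane_frame[OF n, of "X - P"] inner_diff_right)
qed

lemma perpendicular_affine_hull_iff:
  assumes n: "n \<bullet> n = 1"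
  shows "perpendicular {x. n \<bullet> x = c} (affine hull {P, Q}) \<longleftrightarrow> turn n \<bullet> P = turn n \<bullet> Q"
proof
  assume perp: "perpendicular {x. n \<bullet> x = c} (affine hull {P, Q})"
  have "c *\<^sub>R n + turn n \<in> {x. n \<bullet> x = c}" "c *\<^sub>R n \<in> {x. n \<bullet> x = c}"
    using n by (simp_all add: inner_add_right)
  moreover have "P \<in> affine hull {P, Q}" "Q \<in> affine hull {P, Q}"
    by (auto intro: hull_inc)
  ultimately have "(c *\<^sub>R n + turn n - c *\<^sub>R n) \<bullet> (P - Q) = 0"
    using perp unfolding perpendicular_def by blast
  then show "turn n \<bullet> P = turn n \<bullet> Q"
    by (simp add: inner_diff_right)
next
  assume eq: "turn n \<bullet> P = turn n \<bullet> Q"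
  have "affine hull {P, Q} \<subseteq> {x. turn n \<bullet> x = turn n \<bullet> P}"
    by (rule hull_minimal) (simp_all add: eq affine_hyperplane)
  then have hull: "x \<in> affine hull {P, Q} \<Longrightarrow> turn n \<bullet> x = turn n \<bullet> P" for x
    by blast
  show "perpendicular {x. n \<bullet> x = c} (affine hull {P, Q})"
    unfolding perpendicular_def
  proof (intro ballI)
    fix a a' x y
    assume "a \<in> {x. n \<bullet> x = c}" "a' \<in> {x. n \<bullet> x = c}"
      and "x \<in> affine hull {P, Q}" "y \<in> affine hull {P, Q}"
    then have "n \<bullet> (a - a') = 0" "turn n \<bullet> (x - y) = 0"
      using hull by (auto simp: inner_diff_right)
    then show "(a - a') \<bullet> (x - y) = 0"
      by (simp add: plane_frame[OF n, of "a - a'"])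
  qed
qed

text \<open>
  The reason why replicas of one line under different affinities meet only on the axis, unless
  the line is perpendicular to the axis: a point common to two replicas comes from two points of
  the line that lie on one perpendicular.
\<close>

lemma line_eq_perpendicular:
  assumes n: "n \<bullet> n = 1" and l: "is_line l"
    and "X \<in> l" "P \<in> l" "X \<noteq> P" "turn n \<bullet> X = turn n \<bullet> P"
  shows "l = {Y. turn n \<bullet> Y = turn n \<bullet> P}"
proof -
  obtain u b where u: "u \<noteq> 0" "l = {x. u \<bullet> x = b}"
    using l is_line_iff_hyperplane by blast
  have "n \<bullet> X \<noteq> n \<bullet> P"
    using assms(5,6) plane_frame_eqI[OF n] by blast
  moreover have "u \<bullet> (X - P) = 0"
    using assms u by (simp add: inner_diff_right)
  ultimately have un: "n \<bullet> u = 0"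
    using assms(6) by (simp add: plane_frame[OF n, of u] inner_diff_right)
  then have ut: "turn n \<bullet> u \<noteq> 0"
    using u(1) plane_frame_eqI[OF n, of u 0] by auto
  have "u \<bullet> Y = (turn n \<bullet> u) * (turn n \<bullet> Y)" for Y
    using un by (simp add: plane_frame[OF n, of u])
  with ut u(2) \<open>P \<in> l\<close> show ?thesis
    by auto
qed

section \<open>Incidences of a replication in general position\<close>

locale general_replication =
  fixes m k :: nat and C :: configuration and A :: "point set" and \<alpha> :: "nat \<Rightarrow> point \<Rightarrow> point"
    and n :: point and c :: real and \<rho> :: "nat \<Rightarrow> real"
  assumes k: "k \<ge> 1"
    and config: "geometric_configuration m (k - 1) C"
    and axis: "replication_axis C A"
    and general: "no_unintended_incidences k A \<alpha> C"
    and n: "n \<bullet> n = 1"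
    and A: "A = {x. n \<bullet> x = c}"
    and replica_map_stretch: "\<And>i. i < k \<Longrightarrow> replica_map \<alpha> i = stretch n c (\<rho> i)"
    and ratio_nonzero: "\<And>i. i < k \<Longrightarrow> \<rho> i \<noteq> 0"
    and ratio_inj: "inj_on \<rho> {..<k}"
begin

abbreviation "points \<equiv> fst C"
abbreviation "lines \<equiv> snd C"
abbreviation "s i \<equiv> stretch n c (\<rho> i)"
abbreviation "F \<equiv> axis_point A"
abbreviation "perp \<equiv> perpendicular_through A"
abbreviation "D \<equiv> affine_replication k A \<alpha> C"

lemma finite_C: "finite points" "finite lines" "card points = m" "card lines = m"
  and is_line_C: "l \<in> lines \<Longrightarrow> is_line l"
  and lines_through: "P \<in> points \<Longrightarrow> card {l \<in> lines. P \<in> l} = k - 1"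
  and points_on: "l \<in> lines \<Longrightarrow> card {P \<in> points. P \<in> l} = k - 1"
  using config by (auto simp: geometric_configuration_def)

lemma perp_iff: "X \<in> perp P \<longleftrightarrow> turn n \<bullet> X = turn n \<bullet> P"
  unfolding A perpendicular_through_hyperplane[OF n] by simp

lemma axis_Int_line:
  assumes "l \<in> lines"
  shows "A \<inter> l = {F l}"
proof -
  obtain X where X: "A \<inter> l = {X}"
    using axis assms by (auto simp: replication_axis_def)
  then have "F l = X" by (simp add: axis_point_def)
  with X show ?thesis by simp
qed

lemma stretch_axis_point: "l \<in> lines \<Longrightarrow> s i (F l) = F l"
  using axis_Int_line[of l] by (intro stretch_on_axis) (auto simp: A)

lemma axis_point_notin_perp: "l \<in> lines \<Longrightarrow> P \<in> points \<Longrightarrow> F l \<notin> perp P"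
  using general by (auto simp: no_unintended_incidences_def)

lemma stretch_in_perp_iff:
  assumes "P \<in> points" "Q \<in> points"
  shows "s i P \<in> perp Q \<longleftrightarrow> P = Q"
proof -
  have "P = Q" if "turn n \<bullet> P = turn n \<bullet> Q"
  proof (rule ccontr)
    assume "P \<noteq> Q"
    then have "\<not> perpendicular A (affine hull {P, Q})"
      using axis assms by (auto simp: replication_axis_def)
    with that show False
      by (simp add: A perpendicular_affine_hull_iff[OF n])
  qed
  then show ?thesis by (auto simp: perp_iff)
qed

lemma axis_point_in_stretch_iff:
  assumes "l \<in> lines" "l' \<in> lines" "i < k"
  shows "F l \<in> s i ` l' \<longleftrightarrow> l = l'"
proof
  assume "F l \<in> s i ` l'"
  then have "s i (F l) \<in> s i ` l'"
    using stretch_axis_point assms by simp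
  then have "F l \<in> l'"
    using inj_stretch[OF n ratio_nonzero] assms by (simp add: inj_image_mem_iff)
  then have "A \<inter> (l \<inter> l') \<noteq> {}"
    using axis_Int_line assms by blast
  then show "l = l'"
    using axis assms by (auto simp: replication_axis_def)
next
  assume "l = l'"
  moreover have "F l \<in> l" using axis_Int_line assms by blast
  ultimately show "F l \<in> s i ` l'"
    using stretch_axis_point[of l i] assms by (metis imageI)
qed

text \<open>
  A point \<open>P\<close> of \<open>l\<close> is not on the axis, since it would be the axis point of \<open>l\<close> and lie on
  its own perpendicular. Thus, for \<open>i \<noteq> j\<close>, the point that \<open>s j\<close> maps to \<open>s i P\<close> is a second
  point of the perpendicular through \<open>P\<close>, and it is not on \<open>l\<close> because \<open>l\<close>, having an axis
  point outside that perpendicular, contains only one of its points.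
\<close>

lemma stretch_in_stretch_iff:
  assumes P: "P \<in> points" and l: "l \<in> lines" and ij: "i < k" "j < k"
  shows "s i P \<in> s j ` l \<longleftrightarrow> i = j \<and> P \<in> l"
proof
  assume inc: "s i P \<in> s j ` l"
  then have "replica_map \<alpha> i P \<in> replica_map \<alpha> j ` l"
    using ij by (simp add: replica_map_stretch)
  then have Pl: "P \<in> l"
    using general assms by (auto simp: no_unintended_incidences_def)
  obtain X where X: "X \<in> l" "s i P = s j X"
    using inc by blast
  have tX: "turn n \<bullet> X = turn n \<bullet> P"
    using X(2) by (metis turn_inner_stretch)
  have "P \<noteq> F l"
    using axis_point_notin_perp[OF l P] by (auto simp: perp_iff)
  then have "P \<notin> A"
    using axis_Int_line[OF l] Pl by blast
  then have height: "n \<bullet> P - c \<noteq> 0"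
    by (simp add: A)
  have "X = P"
  proof (rule ccontr)
    assume "X \<noteq> P"
    then have "l = {Y. turn n \<bullet> Y = turn n \<bullet> P}"
      using line_eq_perpendicular[OF n is_line_C[OF l] X(1) Pl] tX by simp
    moreover have "F l \<in> l"
      using axis_Int_line[OF l] by blast
    ultimately show False
      using axis_point_notin_perp[OF l P] by (simp add: perp_iff)
  qed
  with X(2) have "\<rho> i * (n \<bullet> P - c) = \<rho> j * (n \<bullet> P - c)"
    by (metis height_stretch[OF n])
  with height have "\<rho> i = \<rho> j" by simp
  with ratio_inj ij have "i = j" by (auto dest: inj_onD)
  with Pl show "i = j \<and> P \<in> l" by simp
qed auto

lemma stretch_point_inj:
  assumes P: "P \<in> points" "Q \<in> points" and ij: "i < k" "j < k" and eq: "s i P = s j Q"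
  shows "i = j \<and> P = Q"
proof -
  have PQ: "P = Q"
    using eq stretch_in_perp_iff[OF P, of i] by (simp add: perp_iff)
  have "i = j"
  proof (cases "k = 1")
    case True
    with ij show ?thesis by simp
  next
    case False
    then have "card {l \<in> lines. P \<in> l} > 0"
      using k lines_through[OF P(1)] by simp
    then obtain l where "l \<in> lines" "P \<in> l"
      by (force simp: card_gt_0_iff)
    with stretch_in_stretch_iff[of P l i j] eq PQ P ij show ?thesis by auto
  qed
  with PQ show ?thesis by simp
qed

lemma stretch_line_inj:
  assumes l: "l \<in> lines" "l' \<in> lines" and ij: "i < k" "j < k" and eq: "s i ` l = s j ` l'"
  shows "i = j \<and> l = l'"
proof -
  have ll': "l = l'"
    using axis_point_in_stretch_iff[OF l(1,2) ij(2)] axis_point_in_stretch_iff[OF l(1,1) ij(1)] eq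
    by simp
  have "i = j"
  proof (cases "k = 1")
    case True
    with ij show ?thesis by simp
  next
    case False
    then have "card {P \<in> points. P \<in> l} > 0"
      using k points_on[OF l(1)] by simp
    then obtain P where "P \<in> points" "P \<in> l"
      by (force simp: card_gt_0_iff)
    with stretch_in_stretch_iff[of P l i j] eq ll' l ij show ?thesis by auto
  qed
  with ll' show ?thesis by simp
qed

lemma axis_point_neq_stretch: "l \<in> lines \<Longrightarrow> P \<in> points \<Longrightarrow> F l \<noteq> s i P"
  using axis_point_notin_perp[of l P] by (auto simp: perp_iff)

lemma perp_neq_stretch: "l \<in> lines \<Longrightarrow> P \<in> points \<Longrightarrow> i < k \<Longrightarrow> s i ` l \<noteq> perp P"
  using axis_point_notin_perp[of l P] axis_point_in_stretch_iff[of l l i] by auto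

lemma inj_on_axis_point: "inj_on F lines"
  using axis_point_in_stretch_iff[where i = 0] k by (metis inj_onI less_eq_Suc_le One_nat_def)

lemma inj_on_perp: "inj_on perp points"
proof (rule inj_onI)
  fix P Q assume PQ: "P \<in> points" "Q \<in> points" "perp P = perp Q"
  moreover have "s 0 P \<in> perp P" by (simp add: perp_iff)
  ultimately show "P = Q" using stretch_in_perp_iff by blast
qed

section \<open>The counts\<close>

lemma points_D: "fst D = (\<lambda>(i, P). s i P) ` ({..<k} \<times> points) \<union> F ` lines"
  by (auto simp: affine_replication_def replica_def replica_map_stretch)

lemma lines_D: "snd D = (\<lambda>(i, l). s i ` l) ` ({..<k} \<times> lines) \<union> perp ` points"
  by (auto simp: affine_replication_def replica_def replica_map_stretch)

lemma point_D_iff: "X \<in> fst D \<longleftrightarrow> (\<exists>i<k. \<exists>P\<in>points. X = s i P) \<or> (\<exists>l\<in>lines. X = F l)"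
  unfolding points_D by auto

lemma line_D_iff: "L \<in> snd D \<longleftrightarrow> (\<exists>i<k. \<exists>l\<in>lines. L = s i ` l) \<or> (\<exists>P\<in>points. L = perp P)"
  unfolding lines_D by auto

lemma card_points_D: "card (fst D) = (k + 1) * m"
proof -
  have "inj_on (\<lambda>(i, P). s i P) ({..<k} \<times> points)"
    by (auto intro!: inj_onI dest: stretch_point_inj)
  moreover have "(\<lambda>(i, P). s i P) ` ({..<k} \<times> points) \<inter> F ` lines = {}"
    using axis_point_neq_stretch[symmetric] by auto
  ultimately show ?thesis
    unfolding points_D using finite_C inj_on_axis_point
    by (subst card_Un_disjoint) (simp_all add: card_image card_cartesian_product)
qed

lemma card_lines_D: "card (snd D) = (k + 1) * m"
proof -
  have "inj_on (\<lambda>(i, l). s i ` l) ({..<k} \<times> lines)"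
    by (auto intro!: inj_onI dest: stretch_line_inj)
  moreover have "(\<lambda>(i, l). s i ` l) ` ({..<k} \<times> lines) \<inter> perp ` points = {}"
    using perp_neq_stretch by fastforce
  ultimately show ?thesis
    unfolding lines_D using finite_C inj_on_perp
    by (subst card_Un_disjoint) (simp_all add: card_image card_cartesian_product)
qed

lemma lines_through_stretch:
  assumes "i < k" "P \<in> points"
  shows "card {L \<in> snd D. s i P \<in> L} = k"
proof -
  have "{L \<in> snd D. s i P \<in> L} = insert (perp P) ((\<lambda>l. s i ` l) ` {l \<in> lines. P \<in> l})" (is "?L = ?R")
  proof
    \<comment> \<open>Membership in a replicated line has to stay folded for the incidence rules to rewrite it.\<close>
    show "?L \<subseteq> ?R"
      using assms by (auto simp: line_D_iff stretch_in_stretch_iff stretch_in_perp_iff del: imageE)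
    show "?R \<subseteq> ?L"
      using assms unfolding lines_D by (auto simp: perp_iff)
  qed
  moreover have "perp P \<notin> (\<lambda>l. s i ` l) ` {l \<in> lines. P \<in> l}"
    using assms perp_neq_stretch by blast
  moreover have "inj_on (\<lambda>l. s i ` l) {l \<in> lines. P \<in> l}"
    using assms by (auto intro!: inj_onI dest: stretch_line_inj)
  ultimately show ?thesis
    using finite_C k assms by (simp add: card_image lines_through)
qed

lemma lines_through_axis_point:
  assumes "l \<in> lines"
  shows "card {L \<in> snd D. F l \<in> L} = k"
proof -
  have "{L \<in> snd D. F l \<in> L} = (\<lambda>i. s i ` l) ` {..<k}" (is "?L = ?R")
  proof
    show "?L \<subseteq> ?R"
      using assms by (auto simp: line_D_iff axis_point_in_stretch_iff axis_point_notin_perp del: imageE)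
    show "?R \<subseteq> ?L"
      using assms unfolding lines_D by (auto simp: axis_point_in_stretch_iff)
  qed
  moreover have "inj_on (\<lambda>i. s i ` l) {..<k}"
    using assms by (auto intro!: inj_onI dest: stretch_line_inj)
  ultimately show ?thesis by (simp add: card_image)
qed

lemma points_on_stretch:
  assumes "i < k" "l \<in> lines"
  shows "card {P \<in> fst D. P \<in> s i ` l} = k"
proof -
  have "{P \<in> fst D. P \<in> s i ` l} = insert (F l) (s i ` {P \<in> points. P \<in> l})" (is "?L = ?R")
  proof
    show "?L \<subseteq> ?R"
      using assms by (auto simp: point_D_iff stretch_in_stretch_iff axis_point_in_stretch_iff del: imageE)
    show "?R \<subseteq> ?L"
      using assms unfolding points_D by (auto simp: axis_point_in_stretch_iff)
  qed
  moreover have "F l \<notin> s i ` {P \<in> points. P \<in> l}"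
    using assms axis_point_neq_stretch by blast
  moreover have "inj_on (s i) {P \<in> points. P \<in> l}"
    using assms by (auto intro!: inj_onI dest: stretch_point_inj)
  ultimately show ?thesis
    using finite_C k assms by (simp add: card_image points_on)
qed

lemma points_on_perp:
  assumes "P \<in> points"
  shows "card {X \<in> fst D. X \<in> perp P} = k"
proof -
  have "{X \<in> fst D. X \<in> perp P} = (\<lambda>i. s i P) ` {..<k}"
    using assms unfolding points_D
    by (auto simp: stretch_in_perp_iff axis_point_notin_perp)
  moreover have "inj_on (\<lambda>i. s i P) {..<k}"
    using assms by (auto intro!: inj_onI dest: stretch_point_inj)
  ultimately show ?thesis by (simp add: card_image)
qed

lemma is_line_D: "L \<in> snd D \<Longrightarrow> is_line L"
proof -
  have "is_line (perp P)" for P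
  proof -
    have "turn n \<noteq> 0" using n by auto
    moreover have "perp P = {X. turn n \<bullet> X = turn n \<bullet> P}" by (auto simp: perp_iff)
    ultimately show ?thesis unfolding is_line_iff_hyperplane by blast
  qed
  then show "L \<in> snd D \<Longrightarrow> is_line L"
    unfolding lines_D using is_line_stretch_image[OF n ratio_nonzero is_line_C] by auto
qed

lemma geometric_configuration_D: "geometric_configuration ((k + 1) * m) k D"
proof -
  have "finite (fst D)" "finite (snd D)"
    unfolding points_D lines_D using finite_C by auto
  moreover have "card {L \<in> snd D. X \<in> L} = k" if "X \<in> fst D" for X
    using that lines_through_stretch lines_through_axis_point unfolding points_D by auto
  moreover have "card {X \<in> fst D. X \<in> L} = k" if "L \<in> snd D" for L
    using that points_on_stretch points_on_perp unfolding lines_D by auto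
  ultimately show ?thesis
    using card_points_D card_lines_D is_line_D by (simp add: geometric_configuration_def)
qed

lemma has_parallel_pencil_D: "has_parallel_pencil m D"
  unfolding has_parallel_pencil_def
proof (intro exI conjI)
  show "perp ` points \<subseteq> snd D" by (simp add: lines_D)
  show "finite (perp ` points)" "card (perp ` points) = m"
    using finite_C inj_on_perp by (simp_all add: card_image)
  have "affine_parallel (perp P) (perp Q)" for P Q
    unfolding affine_parallel_def
  proof (intro exI set_eqI iffI)
    fix X assume "X \<in> perp Q"
    then have "P - Q + X \<in> perp P" by (simp add: perp_iff inner_add_right inner_diff_right)
    then show "X \<in> (+) (Q - P) ` perp P"
      by (rule rev_image_eqI) simp
  qed (auto simp: perp_iff inner_add_right inner_diff_right)
  then show "\<forall>l\<in>perp ` points. \<forall>l'\<in>perp ` points. affine_parallel l l'" by blast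
qed

end

text \<open>Index \<open>0\<close> gets the ratio \<open>1\<close> of the identity, which no affinity has.\<close>

lemma replication_in_general_position:
  assumes k: "k \<ge> 1" and config: "geometric_configuration m (k - 1) C"
    and axis: "replication_axis C A" and aff: "replication_affinities k A \<alpha>"
    and general: "no_unintended_incidences k A \<alpha> C"
  shows "geometric_configuration ((k + 1) * m) k (affine_replication k A \<alpha> C) \<and>
    has_parallel_pencil m (affine_replication k A \<alpha> C)"
proof -
  obtain n c where n: "n \<bullet> n = 1" and A: "A = {x. n \<bullet> x = c}"
    using axis is_line_unit_normal by (auto simp: replication_axis_def)
  have "\<forall>i\<in>{1..k - 1}. \<exists>r. r \<noteq> 0 \<and> r \<noteq> 1 \<and> \<alpha> i = stretch n c r"
    using aff by (simp add: replication_affinities_def A orthogonal_axial_affinity_iff_stretch[OF n])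
  then obtain \<sigma> where \<sigma>: "\<And>i. i \<in> {1..k - 1} \<Longrightarrow> \<sigma> i \<noteq> 0 \<and> \<sigma> i \<noteq> 1 \<and> \<alpha> i = stretch n c (\<sigma> i)"
    by metis
  define \<rho> where "\<rho> i = (if i = 0 then 1 else \<sigma> i)" for i
  have \<rho>: "\<rho> i \<noteq> 0" "replica_map \<alpha> i = stretch n c (\<rho> i)" if "i < k" for i
    using \<sigma>[of i] that by (auto simp: \<rho>_def replica_map_def)
  have "inj_on \<rho> {..<k}"
  proof (rule inj_onI)
    fix i j assume ij: "i \<in> {..<k}" "j \<in> {..<k}" "\<rho> i = \<rho> j"
    show "i = j"
    proof (cases "i = 0 \<or> j = 0")
      case True
      with ij \<sigma>[of i] \<sigma>[of j] show ?thesis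
        by (cases "i = 0"; cases "j = 0") (auto simp: \<rho>_def)
    next
      case False
      with ij have "i \<in> {1..k - 1}" "j \<in> {1..k - 1}" "\<sigma> i = \<sigma> j"
        by (auto simp: \<rho>_def)
      moreover from this have "\<alpha> i = \<alpha> j"
        using \<sigma>[of i] \<sigma>[of j] by metis
      ultimately show ?thesis
        using aff unfolding replication_affinities_def by (meson inj_onD)
    qed
  qed
  with assms n A \<rho> interpret general_replication m k C A \<alpha> n c \<rho>
    by unfold_locales auto
  show ?thesis
    using geometric_configuration_D has_parallel_pencil_D by simp
qed

section \<open>Existence of an axis and affinities in general position\<close>

text \<open>
  The vector \<open>(1, t)\<close> is orthogonal to a given nonzero vector for at most one \<open>t\<close>.
\<close>

lemma unit_vector_orthogonal_to_none:
  fixes V :: "point set"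
  assumes "finite V" "0 \<notin> V"
  obtains n where "n \<bullet> n = 1" "\<And>v. v \<in> V \<Longrightarrow> n \<bullet> v \<noteq> 0"
proof -
  obtain t where t: "t \<notin> (\<lambda>v. - (v $ 1) / v $ 2) ` V"
    using ex_new_if_finite[OF infinite_UNIV_char_0, of "(\<lambda>v. - (v $ 1) / v $ 2) ` V"] assms(1)
    by blast
  define w :: point where "w = vector [1, t]"
  have w: "w $ 1 = 1" "w $ 2 = t" by (simp_all add: w_def)
  have "w \<noteq> 0" using w(1) by auto
  define n where "n = w /\<^sub>R norm w"
  have "n \<bullet> n = 1"
    using \<open>w \<noteq> 0\<close> by (simp add: n_def dot_square_norm power2_eq_square)
  moreover have "n \<bullet> v \<noteq> 0" if v: "v \<in> V" for v
  proof
    assume "n \<bullet> v = 0"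
    then have eq: "v $ 1 + t * v $ 2 = 0"
      using \<open>w \<noteq> 0\<close> by (simp add: n_def inner_plane[of w] w)
    have "v \<noteq> 0"
      using v assms(2) by blast
    with eq have "v $ 2 \<noteq> 0"
      by (auto simp: vec_eq_iff forall_2)
    with eq have "t = - (v $ 1) / v $ 2" by (simp add: field_simps)
    with t v show False by blast
  qed
  ultimately show thesis by (rule that)
qed

text \<open>
  For \<open>T\<close> above all \<open>\<bar>b\<bar>\<close> and all \<open>1 / \<bar>b\<bar>\<close>, the powers of \<open>T\<close> with positive exponent are
  too large, and those with negative exponent too small, to be in \<open>B\<close>.
\<close>

lemma power_quotients_avoid_finite:
  fixes B :: "real set"
  assumes "finite B"
  obtains T where "T > 1" "\<And>i j :: nat. i \<noteq> j \<Longrightarrow> T ^ i / T ^ j \<notin> B"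
proof -
  define T where "T = 2 + (\<Sum>b\<in>B. \<bar>b\<bar> + 1 / \<bar>b\<bar>)"
  have nonneg: "0 \<le> (\<Sum>b\<in>B. \<bar>b\<bar> + 1 / \<bar>b\<bar>)"
    by (rule sum_nonneg) simp
  then have T1: "T > 1" by (simp add: T_def)
  have big: "\<bar>b\<bar> < T" "1 / \<bar>b\<bar> < T" if "b \<in> B" for b
  proof -
    have "\<bar>b\<bar> + 1 / \<bar>b\<bar> \<le> (\<Sum>b\<in>B. \<bar>b\<bar> + 1 / \<bar>b\<bar>)"
      using assms that by (intro member_le_sum) auto
    moreover have "0 \<le> \<bar>b\<bar>" "0 \<le> 1 / \<bar>b\<bar>" by simp_all
    ultimately show "\<bar>b\<bar> < T" "1 / \<bar>b\<bar> < T" unfolding T_def by linarith+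
  qed
  have quotient: "T \<le> T ^ i / T ^ j" if "j < i" for i j :: nat
  proof -
    have "T ^ i / T ^ j = T ^ (i - j)" using that T1 by (simp add: power_diff)
    moreover have "T ^ 1 \<le> T ^ (i - j)" using that T1 by (intro power_increasing) auto
    ultimately show ?thesis by simp
  qed
  have "T ^ i / T ^ j \<notin> B" if "i \<noteq> j" for i j :: nat
  proof
    assume B: "T ^ i / T ^ j \<in> B"
    show False
    proof (cases "j < i")
      case True
      with big(1)[OF B] quotient[of j i] show False by linarith
    next
      case False
      have "1 / \<bar>T ^ i / T ^ j\<bar> = T ^ j / T ^ i" using T1 by simp
      with big(2)[OF B] quotient[of i j] False that show False by simp
    qed
  qed
  with T1 show thesis by (rule that)
qed

lemma distinct_lines_finite_Int:
  assumes "is_line l" "is_line l'" "l \<noteq> l'"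
  shows "finite (l \<inter> l')"
proof (rule ccontr)
  assume "infinite (l \<inter> l')"
  then obtain Y where Y: "Y \<in> l \<inter> l'"
    using infinite_imp_nonempty by blast
  have "infinite (l \<inter> l' - {Y})"
    using \<open>infinite (l \<inter> l')\<close> by simp
  then obtain X where "X \<in> l \<inter> l' - {Y}"
    using infinite_imp_nonempty by blast
  with Y have XY: "X \<in> l \<inter> l'" "Y \<in> l \<inter> l'" "X \<noteq> Y"
    by auto
  \<comment> \<open>In the frame whose normal is the direction \<open>X - Y\<close>, both lines are the perpendicular
    through \<open>Y\<close>.\<close>
  define n where "n = (X - Y) /\<^sub>R norm (X - Y)"
  have "n \<bullet> n = 1"
    using XY by (simp add: n_def dot_square_norm power2_eq_square)
  moreover have "turn n \<bullet> (X - Y) = 0"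
  proof -
    have "X - Y = norm (X - Y) *\<^sub>R n" using XY by (simp add: n_def)
    then show ?thesis by (metis inner_scaleR_right mult_zero_right turn_inner_self(1))
  qed
  ultimately have "l = {Z. turn n \<bullet> Z = turn n \<bullet> Y}" "l' = {Z. turn n \<bullet> Z = turn n \<bullet> Y}"
    using XY assms line_eq_perpendicular[of n _ X Y] by (auto simp: inner_diff_right)
  with assms show False by simp
qed

lemma exists_general_position:
  assumes config: "finite (fst C)" "finite (snd C)" "\<forall>l\<in>snd C. is_line l"
  shows "\<exists>A \<alpha>. replication_axis C A \<and> replication_affinities k A \<alpha> \<and>
    no_unintended_incidences k A \<alpha> C"
proof -
  obtain u b where u: "\<And>l. l \<in> snd C \<Longrightarrow> u l \<noteq> 0 \<and> l = {x. u l \<bullet> x = b l}"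
    using config(3) unfolding is_line_iff_hyperplane by metis

  \<comment> \<open>The direction of the axis. Every condition on \<open>turn n\<close> is turned into one on \<open>n\<close>.\<close>
  define V where "V = u ` snd C \<union> (\<lambda>l. turn (u l)) ` snd C \<union>
    ((\<lambda>(P, Q). turn (P - Q)) ` (fst C \<times> fst C) - {0})"
  have "finite V" "0 \<notin> V"
    using config u by (auto simp: V_def dest: sym)
  then obtain n where n: "n \<bullet> n = 1" and V: "\<And>v. v \<in> V \<Longrightarrow> n \<bullet> v \<noteq> 0"
    using unit_vector_orthogonal_to_none by metis
  have un: "n \<bullet> u l \<noteq> 0" and ut: "turn n \<bullet> u l \<noteq> 0" if "l \<in> snd C" for l
    using that V by (auto simp: V_def inner_turn_left)
  have tPQ: "turn n \<bullet> P \<noteq> turn n \<bullet> Q" if "P \<in> fst C" "Q \<in> fst C" "P \<noteq> Q" for P Q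
  proof -
    have "turn (P - Q) \<in> V" using that by (auto simp: V_def)
    then have "turn n \<bullet> (P - Q) \<noteq> 0"
      using V by (simp add: inner_turn_left)
    then show ?thesis by (simp add: inner_diff_right)
  qed

  \<comment> \<open>The offset of the axis. The second set consists of the heights at which a line of the
    configuration meets the perpendicular through one of the points.\<close>
  define X where "X = (\<lambda>x. n \<bullet> x) ` (\<Union>(l, l')\<in>{(l, l') \<in> snd C \<times> snd C. l \<noteq> l'}. l \<inter> l') \<union>
    (\<lambda>(l, P). (b l - (turn n \<bullet> u l) * (turn n \<bullet> P)) / (n \<bullet> u l)) ` (snd C \<times> fst C)"
  have "finite {(l, l') \<in> snd C \<times> snd C. l \<noteq> l'}"
    using config by (auto intro: finite_subset[of _ "snd C \<times> snd C"])
  then have "finite (\<Union>(l, l')\<in>{(l, l') \<in> snd C \<times> snd C. l \<noteq> l'}. l \<inter> l')"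
    using config(3) by (intro finite_UN_I) (auto intro: distinct_lines_finite_Int)
  then have "finite X"
    using config by (simp add: X_def)
  then obtain c where c: "c \<notin> X"
    using ex_new_if_finite[OF infinite_UNIV_char_0] by blast
  define A where "A = {x. n \<bullet> x = c}"
  have no_crossing: "A \<inter> (l \<inter> l') = {}" if "l \<in> snd C" "l' \<in> snd C" "l \<noteq> l'" for l l'
    using c that by (auto simp: A_def X_def)
  have off_perp: "turn n \<bullet> Y \<noteq> turn n \<bullet> P"
    if "l \<in> snd C" "P \<in> fst C" "Y \<in> A" "Y \<in> l" for l P Y
  proof
    assume eq: "turn n \<bullet> Y = turn n \<bullet> P"
    have "u l \<bullet> Y = b l"
      using u[OF that(1)] that(4) by blast
    then have "(n \<bullet> u l) * c + (turn n \<bullet> u l) * (turn n \<bullet> P) = b l"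
      using that eq by (simp add: plane_frame[OF n, of "u l" Y] A_def)
    then have "c = (b l - (turn n \<bullet> u l) * (turn n \<bullet> P)) / (n \<bullet> u l)"
      using un[OF that(1)] by (simp add: field_simps)
    then have "c \<in> X"
      using that unfolding X_def by (intro UnI2 rev_image_eqI[of "(l, P)"]) simp_all
    with c show False by simp
  qed
  have meets: "\<exists>Y. A \<inter> l = {Y}" if "l \<in> snd C" for l
  proof -
    \<comment> \<open>The coordinate of the axis point along the axis, from the equation of \<open>l\<close> at height \<open>c\<close>.\<close>
    define h where "h = (b l - (n \<bullet> u l) * c) / (turn n \<bullet> u l)"
    have "(n \<bullet> u l) * c + (turn n \<bullet> u l) * y = b l \<longleftrightarrow> y = h" for y
      using ut[OF that] by (auto simp: h_def field_simps)
    moreover have "Y \<in> l \<longleftrightarrow> u l \<bullet> Y = b l" for Y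
      using u[OF that] by blast
    ultimately have on: "Y \<in> A \<inter> l \<longleftrightarrow> n \<bullet> Y = c \<and> turn n \<bullet> Y = h" for Y
      by (auto simp: A_def plane_frame[OF n, of "u l" Y])
    have Y: "c *\<^sub>R n + h *\<^sub>R turn n \<in> A \<inter> l"
      unfolding on using n by (simp add: inner_add_right turn_inner_turn)
    moreover have "Y = c *\<^sub>R n + h *\<^sub>R turn n" if "Y \<in> A \<inter> l" for Y
      using that Y unfolding on by (intro plane_frame_eqI[OF n]) simp_all
    ultimately show ?thesis by blast
  qed
  have "is_line A"
    using n by (auto simp: A_def is_line_iff_hyperplane intro!: exI[of _ n] exI[of _ c])
  then have axis: "replication_axis C A"
    using no_crossing meets tPQ
    by (auto simp: replication_axis_def A_def perpendicular_affine_hull_iff[OF n])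

  \<comment> \<open>The ratios. No line of the configuration is parallel to the perpendiculars, so a point off
    the axis is moved onto a given line by at most one ratio, the solution of a linear equation.
    For a point on the axis, which does not move, division by zero puts a harmless \<open>1\<close> into \<open>B\<close>.\<close>
  define B where "B = (\<lambda>(l, P). 1 + (b l - u l \<bullet> P) / ((n \<bullet> P - c) * (n \<bullet> u l))) ` (snd C \<times> fst C)"
  have B: "r \<in> B" if "l \<in> snd C" "P \<in> fst C" "P \<notin> l" "stretch n c r P \<in> l" for r l P
  proof -
    have l: "Y \<in> l \<longleftrightarrow> u l \<bullet> Y = b l" for Y
      using u[OF that(1)] by blast
    have eq: "(r - 1) * ((n \<bullet> P - c) * (n \<bullet> u l)) = b l - u l \<bullet> P"
      using that(4) unfolding l by (simp add: stretch_def inner_add_right inner_commute)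
    moreover have "b l - u l \<bullet> P \<noteq> 0"
      using that(3) unfolding l by simp
    ultimately have "(n \<bullet> P - c) * (n \<bullet> u l) \<noteq> 0"
      by auto
    with eq have "r = 1 + (b l - u l \<bullet> P) / ((n \<bullet> P - c) * (n \<bullet> u l))"
      by (simp add: nonzero_eq_divide_eq[symmetric])
    with that show ?thesis
      unfolding B_def by (intro rev_image_eqI[of "(l, P)"]) simp_all
  qed
  have "finite B"
    using config by (simp add: B_def)
  then obtain T where T: "T > 1" and TB: "\<And>i j :: nat. i \<noteq> j \<Longrightarrow> T ^ i / T ^ j \<notin> B"
    using power_quotients_avoid_finite by metis
  define \<alpha> where "\<alpha> i = stretch n c (T ^ i)" for i :: nat
  have "orthogonal_axial_affinity A (\<alpha> i)" if "i \<in> {1..k - 1}" for i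
  proof -
    have "1 < T ^ i"
      using that T by (intro one_less_power) auto
    then have "T ^ i \<noteq> 0" "T ^ i \<noteq> 1"
      by linarith+
    then show ?thesis
      unfolding A_def \<alpha>_def orthogonal_axial_affinity_iff_stretch[OF n] by blast
  qed
  moreover have "inj_on \<alpha> {1..k - 1}"
  proof (rule inj_onI)
    fix i j assume "\<alpha> i = \<alpha> j"
    then have "T ^ i = T ^ j"
      unfolding \<alpha>_def by (rule stretch_ratio_inj[OF n])
    with T show "i = j" by (simp add: power_inject_exp)
  qed
  ultimately have affinities: "replication_affinities k A \<alpha>"
    by (simp add: replication_affinities_def)
  have "replica_map \<alpha> i = stretch n c (T ^ i)" for i
    by (simp add: replica_map_def \<alpha>_def)
  moreover have "P \<in> l" if "P \<in> fst C" "l \<in> snd C"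
    and inc: "stretch n c (T ^ i) P \<in> stretch n c (T ^ j) ` l" for P l i j
  proof (rule ccontr)
    assume "P \<notin> l"
    have "stretch n c (T ^ i / T ^ j) P \<in> l"
      using inc T by (auto simp: stretch_eq_iff[OF n])
    with that \<open>P \<notin> l\<close> TB[of i j] B[of l P] show False
      using T by (cases "i = j") auto
  qed
  moreover have "axis_point A l \<notin> perpendicular_through A P" if "P \<in> fst C" "l \<in> snd C" for P l
  proof -
    obtain Y where Y: "A \<inter> l = {Y}" using meets \<open>l \<in> snd C\<close> by blast
    then have "turn n \<bullet> Y \<noteq> turn n \<bullet> P" using off_perp that by blast
    with Y show ?thesis
      by (simp add: axis_point_def) (simp add: A_def perpendicular_through_hyperplane[OF n])
  qed
  ultimately have "no_unintended_incidences k A \<alpha> C"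
    unfolding no_unintended_incidences_def by auto
  with axis affinities show ?thesis by blast
qed

theorem lemma5:
  fixes m k :: nat and C :: configuration
  assumes "k \<ge> 1"
    and "geometric_configuration m (k - 1) C"
  shows "(\<forall>A \<alpha>. replication_axis C A \<and> replication_affinities k A \<alpha> \<and>
                 no_unintended_incidences k A \<alpha> C \<longrightarrow>
            geometric_configuration ((k + 1) * m) k (affine_replication k A \<alpha> C) \<and>
            has_parallel_pencil m (affine_replication k A \<alpha> C)) \<and>
         (\<exists>A \<alpha>. replication_axis C A \<and> replication_affinities k A \<alpha> \<and>
                 no_unintended_incidences k A \<alpha> C)"
proof -
  have "\<exists>A \<alpha>. replication_axis C A \<and> replication_affinities k A \<alpha> \<and>
      no_unintended_incidences k A \<alpha> C"
    using assms(2) by (intro exists_general_position) (auto simp: geometric_configuration_def)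
  then show ?thesis
    using replication_in_general_position[OF assms] by blast
qed

end
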